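(* For every integer $n\ge0$, $$(-1)^n\sum_{k=0}^n S(n,k)(-1)^k D_k = \sum_{k=0}^n\binom{n}{k}(-1)^k b_k = 1 + \sum_{j=0}^{n-1}(-1)^{j+1}b_j.$$
   Context: $S(n,k)$ are the Stirling numbers of the second kind. $D_n = n!\left(1-\frac1{1!}+\frac1{2!}-\dots+\frac{(-1)^n}{n!}\right)$ are the derangement numbers (with exponential generating function $\frac{e^{-x}}{1-x}$). $b_n=\sum_{k=0}^n S(n,k)$ are the Bell numbers. *)

theory Defs
  imports Complex_Main "HOL-Combinatorics.Stirling"
begin

definition bell :: "nat \<Rightarrow> nat" where
  "bell n = (\<Sum>k\<le>n. Stirling n k)"

definition derangement_number :: "nat \<Rightarrow> real" where
  "derangement_number n = fact n * (\<Sum>k\<le>n. (-1) ^ k / fact k)"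

end

theory Submission
  imports Defs
begin

text \<open>
  Let \<open>L\<close> be the linear functional on polynomials that takes the value \<open>f k\<close> at the falling
  factorial \<open>(x)\<^sub>k\<close>. Then \<open>L (x^n)\<close> is the Stirling transform of \<open>f\<close>, and its signed binomial
  transform is \<open>L ((1 - x)^n) = (-1)^n L ((x - 1)^n)\<close>. The values \<open>g k = L ((x - 1)\<^sub>k)\<close> satisfy
  \<open>f k = g k + k g (k - 1)\<close>, because \<open>(x)\<^sub>k = (x - 1)\<^sub>k + k (x - 1)\<^sub>k\<^sub>-\<^sub>1\<close>, so the binomial transform of
  the Stirling transform of \<open>f\<close> is \<open>(-1)^n\<close> times the Stirling transform of \<open>g\<close>.

  The Bell numbers are the case \<open>f k = 1\<close>, for which \<open>g k = (-1)^k D(k)\<close>: this is the first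
  equation. For \<open>f k = k + 1\<close>, whose Stirling transform is the shifted Bell sequence, \<open>g k = 1\<close>:
  this gives the increments of the binomial transform of the Bell numbers, hence the second equation.
\<close>

definition Stirling_transform :: "(nat \<Rightarrow> 'a::comm_semiring_1) \<Rightarrow> nat \<Rightarrow> 'a" where
  "Stirling_transform f n = (\<Sum>k\<le>n. of_nat (Stirling n k) * f k)"

definition binomial_transform :: "(nat \<Rightarrow> 'a::comm_ring_1) \<Rightarrow> nat \<Rightarrow> 'a" where
  "binomial_transform f n = (\<Sum>k\<le>n. of_nat (n choose k) * (-1) ^ k * f k)"

lemma Stirling_transform_0: "Stirling_transform f 0 = f 0"
  by (simp add: Stirling_transform_def)

lemma Stirling_transform_add:
  "Stirling_transform (\<lambda>k. f k + g k) n = Stirling_transform f n + Stirling_transform g n"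
  by (simp add: Stirling_transform_def distrib_left sum.distrib)

lemma Stirling_transform_Suc:
  "Stirling_transform f (Suc n) = Stirling_transform (\<lambda>k. of_nat k * f k + f (Suc k)) n"
proof -
  have "Stirling_transform f (Suc n) = (\<Sum>k\<le>n. of_nat (Stirling (Suc n) (Suc k)) * f (Suc k))"
    unfolding Stirling_transform_def by (subst sum.atMost_Suc_shift) simp
  also have "\<dots> = (\<Sum>k\<le>n. of_nat (Stirling n (Suc k)) * (of_nat (Suc k) * f (Suc k)))
      + (\<Sum>k\<le>n. of_nat (Stirling n k) * f (Suc k))"
    by (simp add: algebra_simps flip: sum.distrib)
  also have "(\<Sum>k\<le>n. of_nat (Stirling n (Suc k)) * (of_nat (Suc k) * f (Suc k)))
      = (\<Sum>k\<le>Suc n. of_nat (Stirling n k) * (of_nat k * f k))"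
    by (subst sum.atMost_Suc_shift) simp
  also have "\<dots> = (\<Sum>k\<le>n. of_nat (Stirling n k) * (of_nat k * f k))"
    by simp
  finally show ?thesis
    by (simp add: Stirling_transform_def distrib_left sum.distrib)
qed

lemma binomial_transform_0: "binomial_transform f 0 = f 0"
  by (simp add: binomial_transform_def)

lemma binomial_transform_add:
  "binomial_transform (\<lambda>k. f k + g k) n = binomial_transform f n + binomial_transform g n"
  by (simp add: binomial_transform_def distrib_left sum.distrib)

lemma binomial_transform_Suc:
  "binomial_transform f (Suc n) = binomial_transform f n - binomial_transform (\<lambda>k. f (Suc k)) n"
proof -
  have "binomial_transform f (Suc n)
      = f 0 + (\<Sum>k\<le>n. of_nat (n choose Suc k) * (-1) ^ Suc k * f (Suc k))
        - binomial_transform (\<lambda>k. f (Suc k)) n"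
    unfolding binomial_transform_def
    by (subst sum.atMost_Suc_shift) (simp add: algebra_simps sum.distrib sum_negf sum_subtractf)
  also have "f 0 + (\<Sum>k\<le>n. of_nat (n choose Suc k) * (-1) ^ Suc k * f (Suc k))
      = (\<Sum>k\<le>Suc n. of_nat (n choose k) * (-1) ^ k * f k)"
    by (subst sum.atMost_Suc_shift) simp
  also have "\<dots> = binomial_transform f n"
    by (simp add: binomial_transform_def binomial_eq_0)
  finally show ?thesis .
qed

text \<open>At \<open>k = 0\<close> the truncated \<open>g (k - 1)\<close> is harmless, as it is multiplied by \<open>k\<close>.\<close>

lemma binomial_transform_Stirling_transform:
  "binomial_transform (Stirling_transform (\<lambda>k. g k + of_nat k * g (k - 1))) n
    = (-1) ^ n * Stirling_transform g n"
proof (induction n arbitrary: g)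
  case 0
  show ?case
    by (simp add: binomial_transform_0 Stirling_transform_0)
next
  case (Suc n)
  define shift where "shift = (\<lambda>(g :: nat \<Rightarrow> 'a) k. g k + of_nat k * g (k - 1))"
  define g' where "g' = (\<lambda>k. of_nat k * g k + g (Suc k))"
  have shift_recurrence: "of_nat k * shift g k + shift g (Suc k) = shift g k + shift g' k" for k
    by (cases k) (simp_all add: shift_def g'_def algebra_simps)
  have Stirling_shift_Suc: "Stirling_transform (shift g) (Suc k)
      = Stirling_transform (shift g) k + Stirling_transform (shift g') k" for k
    by (simp add: Stirling_transform_Suc shift_recurrence Stirling_transform_add)
  have "binomial_transform (Stirling_transform (shift g)) (Suc n)
      = - binomial_transform (Stirling_transform (shift g')) n"
    by (simp add: binomial_transform_Suc Stirling_shift_Suc binomial_transform_add)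
  also have "\<dots> = (-1) ^ Suc n * Stirling_transform g' n"
    using Suc.IH[of g'] by (simp add: shift_def)
  also have "Stirling_transform g' n = Stirling_transform g (Suc n)"
    by (simp add: Stirling_transform_Suc g'_def)
  finally show ?case
    by (simp add: shift_def)
qed

lemma of_nat_bell_eq_Stirling_transform: "of_nat (bell n) = Stirling_transform (\<lambda>_. 1) n"
  by (simp add: bell_def Stirling_transform_def)

lemma derangement_number_Suc:
  "derangement_number (Suc n) = real (Suc n) * derangement_number n + (-1) ^ Suc n"
proof -
  have "derangement_number (Suc n)
      = fact (Suc n) * (\<Sum>k\<le>n. (-1) ^ k / fact k) + fact (Suc n) * ((-1) ^ Suc n / fact (Suc n))"
    unfolding derangement_number_def sum.atMost_Suc distrib_left ..
  also have "fact (Suc n) * ((-1) ^ Suc n / fact (Suc n)) = (-1 :: real) ^ Suc n"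
    by (simp del: fact_Suc)
  finally show ?thesis
    by (simp add: derangement_number_def mult.assoc)
qed

lemma binomial_transform_bell_eq_derangement:
  "binomial_transform (\<lambda>k. real (bell k)) n
    = (-1) ^ n * Stirling_transform (\<lambda>k. (-1) ^ k * derangement_number k) n"
proof -
  define d where "d = (\<lambda>k. (-1) ^ k * derangement_number k)"
  have derangement_recurrence: "d k + real k * d (k - 1) = 1" for k
  proof (cases k)
    case 0
    then show ?thesis by (simp add: d_def derangement_number_def)
  next
    case (Suc j)
    then show ?thesis
      by (simp add: d_def derangement_number_Suc algebra_simps flip: power_add mult_2)
  qed
  show ?thesis
    using binomial_transform_Stirling_transform[of d n]
    unfolding derangement_recurrence by (simp add: of_nat_bell_eq_Stirling_transform d_def)
qed

lemma binomial_transform_bell_Suc: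
  "binomial_transform (\<lambda>k. of_nat (bell (Suc k))) n = (-1) ^ n * of_nat (bell n)"
  using binomial_transform_Stirling_transform[of "\<lambda>_. 1" n]
  by (simp add: of_nat_bell_eq_Stirling_transform Stirling_transform_Suc add.commute)

lemma binomial_transform_bell:
  "binomial_transform (\<lambda>k. of_nat (bell k)) n = 1 + (\<Sum>j<n. (-1) ^ (j + 1) * of_nat (bell j))"
proof (induction n)
  case 0
  show ?case by (simp add: binomial_transform_0 bell_def)
next
  case (Suc n)
  then show ?case
    by (simp add: binomial_transform_Suc[of _ n] binomial_transform_bell_Suc)
qed

theorem theorem15:
  fixes n :: nat
  shows "(-1) ^ n * (\<Sum>k\<le>n. real (Stirling n k) * (-1) ^ k * derangement_number k)
           = (\<Sum>k\<le>n. real (n choose k) * (-1) ^ k * real (bell k))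
       \<and> (\<Sum>k\<le>n. real (n choose k) * (-1) ^ k * real (bell k))
           = 1 + (\<Sum>j<n. (-1) ^ (j + 1) * real (bell j))"
proof
  show "(-1) ^ n * (\<Sum>k\<le>n. real (Stirling n k) * (-1) ^ k * derangement_number k)
      = (\<Sum>k\<le>n. real (n choose k) * (-1) ^ k * real (bell k))"
    using binomial_transform_bell_eq_derangement[of n]
    by (simp add: Stirling_transform_def binomial_transform_def mult.assoc)
  show "(\<Sum>k\<le>n. real (n choose k) * (-1) ^ k * real (bell k))
      = 1 + (\<Sum>j<n. (-1) ^ (j + 1) * real (bell j))"
    using binomial_transform_bell[of n, where 'a = real]
    by (simp only: binomial_transform_def)
qed

end
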